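(* Let $g$ be a projective normalization function, let $(\hat y,\hat\eta)\notin\mathcal{E}$, and let $(\pi^*,\pi_0^* )$ be an optimal solution of the normalized separation problem $$d_g^*(\hat y,\hat\eta)=\max\{\pi^\top(b-B\hat y)+\pi_0(f^\top\hat y-\hat\eta):\ (\pi,\pi_0)\in\Pi,\ g(B^\top\pi-\pi_0f,\ \pi_0)\le1\}.$$ Put $\tau^*=B^\top\pi^*-\pi_0^*f$ and assume $g$ is differentiable at $(\tau^*,\pi_0^* )$. Then $$d_g^*(\hat y,\hat\eta)=\min\{z\in\mathbb{R}:\ (y,\eta)\in\mathcal{E},\ (y,\eta)=(\hat y,\hat\eta)+z\,\nabla_{(\tau,\pi_0)}g(\tau^*,\pi_0^* )\}.$$
   Context: Data: $f\in\mathbb{R}^n$, $c\in\mathbb{R}^{n'}$, $b\in\mathbb{R}^m$, $A\in\mathbb{R}^{m\times n'}$, $B\in\mathbb{R}^{m\times n}$, $Y\subset\mathbb{Z}^n$. Standing assumption: the mixed-integer program $\min\{c^\top x+f^\top y: Ax+By\ge b,\ x\ge0,\ y\in Y\}$ is feasible and bounded. Let $\Pi=\{(\pi,\pi_0)\in\mathbb{R}^m\times\mathbb{R}:\pi^\top A\le\pi_0c^\top,\ \pi\ge0,\ \pi_0\ge0\}$. For $y\in\mathbb{R}^n$ let $Q(y)=f^\top y+\min\{c^\top x: Ax\ge b-By,\ x\ge0\}$, and let $\mathrm{dom}(Q)$ be the set of $y\in\mathbb{R}^n$ for which this linear program is feasible; $\mathcal{E}=\{(y,\eta)\in\mathbb{R}^{n+1}: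 y\in\mathrm{dom}(Q),\ \eta\ge Q(y)\}$. A projective normalization function is a function $g:\mathbb{R}^n\times\mathbb{R}\to\mathbb{R}$ that is positive homogeneous ($g(\alpha\tau,\alpha\pi_0)=\alpha g(\tau,\pi_0)$ for $\alpha\ge0$) and satisfies $g(\tau,\pi_0)>0$ whenever $(\tau,\pi_0)\ne0$ and $\tau=B^\top\pi-\pi_0f$ for some $(\pi,\pi_0)\in\Pi$. *)

theory Defs
  imports "HOL-Analysis.Analysis"
begin

text \<open>
  The order on \<open>real ^ 'k\<close> is componentwise, so \<open>0 \<le> x\<close> means that every
  component of \<open>x\<close> is nonnegative; \<open>\<pi> v* A\<close> is the row vector \<open>\<pi>\<^sup>T A\<close>,
  i.e. \<open>A\<^sup>T \<pi>\<close>. Index types: \<open>'n\<close> for \<open>y\<close>, \<open>'p\<close> for \<open>x\<close>, \<open>'m\<close> for the rows.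
\<close>

definition mip_feasible_set ::
  "real^'p^'m \<Rightarrow> real^'n^'m \<Rightarrow> real^'m \<Rightarrow> (real^'n) set \<Rightarrow> ((real^'p) \<times> (real^'n)) set"
  where "mip_feasible_set A B b Y = {(x, y). A *v x + B *v y \<ge> b \<and> x \<ge> 0 \<and> y \<in> Y}"

definition mip_feasible :: "real^'p^'m \<Rightarrow> real^'n^'m \<Rightarrow> real^'m \<Rightarrow> (real^'n) set \<Rightarrow> bool"
  where "mip_feasible A B b Y \<longleftrightarrow> mip_feasible_set A B b Y \<noteq> {}"

definition mip_bounded ::
  "real^'p^'m \<Rightarrow> real^'n^'m \<Rightarrow> real^'m \<Rightarrow> real^'p \<Rightarrow> real^'n \<Rightarrow> (real^'n) set \<Rightarrow> bool"
  where "mip_bounded A B b c f Y \<longleftrightarrow>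
    bdd_below ((\<lambda>(x, y). c \<bullet> x + f \<bullet> y) ` mip_feasible_set A B b Y)"

definition Pi_cone :: "real^'p^'m \<Rightarrow> real^'p \<Rightarrow> ((real^'m) \<times> real) set"
  where "Pi_cone A c = {(\<pi>, \<pi>0). \<pi> v* A \<le> \<pi>0 *\<^sub>R c \<and> \<pi> \<ge> 0 \<and> \<pi>0 \<ge> 0}"

definition lp_feasible_set ::
  "real^'p^'m \<Rightarrow> real^'n^'m \<Rightarrow> real^'m \<Rightarrow> real^'n \<Rightarrow> (real^'p) set"
  where "lp_feasible_set A B b y = {x. A *v x \<ge> b - B *v y \<and> x \<ge> 0}"

text \<open>
  The optimal value of the linear program is taken in the extended reals: \<open>\<infinity>\<close> if it is
  infeasible, \<open>-\<infinity>\<close> if it is unbounded, and otherwise its minimum, which a feasible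
  linear program with objective bounded below always attains.
\<close>

definition Q_value ::
  "real^'p^'m \<Rightarrow> real^'n^'m \<Rightarrow> real^'m \<Rightarrow> real^'p \<Rightarrow> real^'n \<Rightarrow> real^'n \<Rightarrow> ereal"
  where "Q_value A B b c f y =
    ereal (f \<bullet> y) + (INF x \<in> lp_feasible_set A B b y. ereal (c \<bullet> x))"

definition dom_Q :: "real^'p^'m \<Rightarrow> real^'n^'m \<Rightarrow> real^'m \<Rightarrow> (real^'n) set"
  where "dom_Q A B b = {y. lp_feasible_set A B b y \<noteq> {}}"

definition epi_Q ::
  "real^'p^'m \<Rightarrow> real^'n^'m \<Rightarrow> real^'m \<Rightarrow> real^'p \<Rightarrow> real^'n \<Rightarrow> ((real^'n) \<times> real) set"
  where "epi_Q A B b c f = {(y, \<eta>). y \<in> dom_Q A B b \<and> ereal \<eta> \<ge> Q_value A B b c f y}"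

definition cut_coeff :: "real^'n^'m \<Rightarrow> real^'n \<Rightarrow> (real^'m) \<times> real \<Rightarrow> (real^'n) \<times> real"
  where "cut_coeff B f = (\<lambda>(\<pi>, \<pi>0). (\<pi> v* B - \<pi>0 *\<^sub>R f, \<pi>0))"

definition projective_normalization ::
  "real^'p^'m \<Rightarrow> real^'n^'m \<Rightarrow> real^'p \<Rightarrow> real^'n \<Rightarrow> ((real^'n) \<times> real \<Rightarrow> real) \<Rightarrow> bool"
  where "projective_normalization A B c f g \<longleftrightarrow>
    (\<forall>\<alpha> \<tau> \<pi>0. \<alpha> \<ge> 0 \<longrightarrow> g (\<alpha> *\<^sub>R \<tau>, \<alpha> * \<pi>0) = \<alpha> * g (\<tau>, \<pi>0)) \<and>
    (\<forall>\<tau> \<pi>0. (\<tau>, \<pi>0) \<noteq> 0 \<and> (\<exists>\<pi>. (\<pi>, \<pi>0) \<in> Pi_cone A c \<and> \<tau> = \<pi> v* B - \<pi>0 *\<^sub>R f)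
       \<longrightarrow> g (\<tau>, \<pi>0) > 0)"

definition sep_feasible_set ::
  "real^'p^'m \<Rightarrow> real^'n^'m \<Rightarrow> real^'p \<Rightarrow> real^'n \<Rightarrow> ((real^'n) \<times> real \<Rightarrow> real)
     \<Rightarrow> ((real^'m) \<times> real) set"
  where "sep_feasible_set A B c f g = {p \<in> Pi_cone A c. g (cut_coeff B f p) \<le> 1}"

definition sep_objective ::
  "real^'n^'m \<Rightarrow> real^'m \<Rightarrow> real^'n \<Rightarrow> (real^'n) \<times> real \<Rightarrow> (real^'m) \<times> real \<Rightarrow> real"
  where "sep_objective B b f = (\<lambda>(y, \<eta>) (\<pi>, \<pi>0). \<pi> \<bullet> (b - B *v y) + \<pi>0 * (f \<bullet> y - \<eta>))"

definition sep_optimal ::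
  "real^'p^'m \<Rightarrow> real^'n^'m \<Rightarrow> real^'m \<Rightarrow> real^'p \<Rightarrow> real^'n \<Rightarrow> ((real^'n) \<times> real \<Rightarrow> real)
     \<Rightarrow> (real^'n) \<times> real \<Rightarrow> (real^'m) \<times> real \<Rightarrow> bool"
  where "sep_optimal A B b c f g u =
    is_arg_max (sep_objective B b f u) (\<lambda>p. p \<in> sep_feasible_set A B c f g)"

text \<open>As a real supremum this is the maximum whenever an optimal solution exists.\<close>

definition sep_value ::
  "real^'p^'m \<Rightarrow> real^'n^'m \<Rightarrow> real^'m \<Rightarrow> real^'p \<Rightarrow> real^'n \<Rightarrow> ((real^'n) \<times> real \<Rightarrow> real)
     \<Rightarrow> (real^'n) \<times> real \<Rightarrow> real"
  where "sep_value A B b c f g u =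
    (SUP p \<in> sep_feasible_set A B c f g. sep_objective B b f u p)"

definition gradient :: "('a::real_inner \<Rightarrow> real) \<Rightarrow> 'a \<Rightarrow> 'a"
  where "gradient g p = (THE D. GDERIV g p :> D)"

lemma GDERIV_gradient:
  fixes g :: "'a::euclidean_space \<Rightarrow> real"
  assumes "g differentiable (at p)"
  shows "GDERIV g p :> gradient g p"
proof -
  obtain g' where g': "(g has_derivative g') (at p)"
    using assms unfolding differentiable_def by blast
  have "linear g'"
    by (rule has_derivative_linear[OF g'])
  then have "g' h = h \<bullet> adjoint g' 1" for h
    by (simp add: adjoint_works)
  then have "g' = (\<lambda>h. h \<bullet> adjoint g' 1)"
    by (rule ext)
  then have D: "GDERIV g p :> adjoint g' 1"
    using g' unfolding gderiv_def by simp
  have "D' = adjoint g' 1" if "GDERIV g p :> D'" for D'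
  proof -
    have "(\<lambda>h. h \<bullet> D') = (\<lambda>h. h \<bullet> adjoint g' 1)"
      using has_derivative_unique[OF that[unfolded gderiv_def] D[unfolded gderiv_def]] .
    then have "\<forall>h. h \<bullet> D' = h \<bullet> adjoint g' 1"
      by (rule fun_cong[THEN allI])
    then show ?thesis
      by (rule vector_eq_ldot[THEN iffD1])
  qed
  with D show ?thesis
    unfolding gradient_def by (rule theI)
qed

end

theory Submission
  imports Defs
begin

text \<open>
  By Farkas' lemma, \<open>(y, \<eta>)\<close> lies in the epigraph iff
  \<open>\<pi>\<^sup>T b \<le> \<tau>\<^sup>T y + \<pi>\<^sub>0 \<eta>\<close> for all \<open>(\<pi>, \<pi>\<^sub>0)\<close> in the cone \<open>\<Pi>\<close>. For a point \<open>u\<close> outside, homogeneity of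
  \<open>g\<close> turns the normalized problem into the statement that the violation at \<open>u\<close> is at most
  \<open>d g(\<tau>, \<pi>\<^sub>0)\<close> on \<open>\<Pi>\<close>, with equality at the optimum \<open>q\<close>, where \<open>g = 1\<close>. Moving from the
  optimum in a direction of \<open>\<Pi>\<close> and differentiating bounds the violation at \<open>u\<close> by
  \<open>d \<nabla>g(q) \<bullet> (\<tau>, \<pi>\<^sub>0)\<close>, which says that \<open>u + d \<nabla>g(q)\<close> satisfies all cuts. Conversely, Euler's
  identity \<open>\<nabla>g(q) \<bullet> q = g(q) = 1\<close> shows that \<open>u + z \<nabla>g(q)\<close> violates the optimal cut for \<open>z < d\<close>.
\<close>

text \<open>A finitely generated cone is a polyhedron, hence closed, so some hyperplane separates
  \<open>v\<close> strictly from it. The threshold \<beta> is negative because the cone contains 0,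
  and invariance under scaling lets it be moved to 0 on the generators.\<close>

lemma finite_convex_cone_hull_separation:
  fixes S :: "'a::euclidean_space set"
  assumes "finite S" and "v \<notin> convex_cone hull S"
  obtains a where "a \<bullet> v < 0" and "\<And>s. s \<in> S \<Longrightarrow> 0 \<le> a \<bullet> s"
proof -
  let ?K = "convex_cone hull S"
  have "closed ?K"
    by (intro polyhedron_imp_closed polyhedron_convex_cone_hull assms(1))
  then obtain a \<beta> where a: "a \<bullet> v < \<beta>" and K: "\<And>x. x \<in> ?K \<Longrightarrow> \<beta> < a \<bullet> x"
    using separating_hyperplane_closed_point[OF convex_convex_cone_hull _ assms(2)] by blast
  have \<beta>: "\<beta> < 0"
    using K[OF convex_cone_hull_contains_0] by simp
  have "0 \<le> a \<bullet> s" if "s \<in> S" for s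
  proof (rule ccontr)
    assume neg: "\<not> 0 \<le> a \<bullet> s"
    \<comment> \<open>This multiple of \<open>s\<close> has inner product exactly \<beta> with
      \<open>a\<close>, contradicting the strict inequality on the cone.\<close>
    have "(\<beta> / (a \<bullet> s)) *\<^sub>R s \<in> ?K"
      using neg \<beta> hull_inc[OF that] by (intro convex_cone_hull_mul) (auto simp: divide_nonpos_neg)
    from K[OF this] show False
      using neg by simp
  qed
  with a \<beta> show thesis
    by (intro that[of a]) auto
qed

text \<open>The pairs (right-hand side, cost bound) that some \<open>x\<close> can meet form a
  convex cone \<open>T\<close>. If (\<open>v\<close>, \<open>w\<close>) lay outside the cone
  generated by \<open>S\<close>, a separating vector would yield a multiplier in
  \<open>Pi_cone A c\<close> violating the hypothesis.\<close>

lemma farkas_matrix: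
  fixes A :: "real^'p^'m"
  assumes le: "\<And>\<pi> \<pi>0. (\<pi>, \<pi>0) \<in> Pi_cone A c \<Longrightarrow> \<pi> \<bullet> v \<le> \<pi>0 * w"
  obtains x where "0 \<le> x" and "v \<le> A *v x" and "c \<bullet> x \<le> w"
proof -
  \<comment> \<open>The generators are the columns of \<open>A\<close> with their costs, the
    directions relaxing one row, and the direction raising the cost bound.\<close>
  define S where "S = range (\<lambda>j. (A *v axis j 1, c $ j)) \<union> range (\<lambda>i. (- axis i 1, 0)) \<union> {(0, 1)}"
  define T where "T = {(r, t). \<exists>x\<ge>0. r \<le> A *v x \<and> c \<bullet> x \<le> t}"
  have axis: "(0::real^'k) \<le> axis j 1" for j :: "'k::finite"
    by (simp add: less_eq_vec_def axis_def)
  have "S \<subseteq> T"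
  proof -
    have "(A *v axis j 1, c $ j) \<in> T" for j
      unfolding T_def by (auto intro!: exI[of _ "axis j 1"] simp: axis inner_axis)
    moreover have "(- axis i 1, 0) \<in> T" "(0, 1) \<in> T" for i
      unfolding T_def using axis[of i] by (auto intro!: exI[of _ 0])
    ultimately show ?thesis
      unfolding S_def by blast
  qed
  moreover have "convex_cone T"
    unfolding convex_cone_iff
  proof (intro conjI ballI allI impI)
    show "0 \<in> T"
      unfolding T_def by (auto simp: zero_prod_def intro!: exI[of _ 0])
  next
    fix p q assume "p \<in> T" "q \<in> T"
    then obtain x y where "0 \<le> x" "fst p \<le> A *v x" "c \<bullet> x \<le> snd p"
      "0 \<le> y" "fst q \<le> A *v y" "c \<bullet> y \<le> snd q"
      unfolding T_def by auto
    then show "p + q \<in> T"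
      unfolding T_def
      by (auto simp: plus_prod_def matrix_vector_right_distrib inner_add_right
          intro!: exI[of _ "x + y"] add_mono)
  next
    fix p and k :: real assume "p \<in> T" "0 \<le> k"
    then obtain x where "0 \<le> x" "fst p \<le> A *v x" "c \<bullet> x \<le> snd p"
      unfolding T_def by auto
    with \<open>0 \<le> k\<close> show "k *\<^sub>R p \<in> T"
      unfolding T_def
      by (auto simp: scaleR_prod_def matrix_vector_mult_scaleR
          intro!: exI[of _ "k *\<^sub>R x"] scaleR_left_mono scaleR_nonneg_nonneg mult_left_mono)
  qed
  ultimately have "convex_cone hull S \<subseteq> T"
    by (rule hull_minimal)
  moreover have "(v, w) \<in> convex_cone hull S"
  proof (rule ccontr)
    assume notin: "(v, w) \<notin> convex_cone hull S"
    have "finite S"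
      unfolding S_def by simp
    from finite_convex_cone_hull_separation[OF this notin] obtain a \<alpha>
      where neg: "a \<bullet> v + \<alpha> * w < 0" and S: "\<And>s. s \<in> S \<Longrightarrow> 0 \<le> (a, \<alpha>) \<bullet> s"
      by (metis inner_Pair inner_real_def surj_pair)
    have "- (a v* A) $ j \<le> \<alpha> * c $ j" for j
      using S[of "(A *v axis j 1, c $ j)"]
      by (simp add: S_def inner_axis flip: dot_lmul_matrix)
    moreover have "(- a v* A) $ j = - (a v* A) $ j" for j
      using scaleR_vector_matrix_assoc[of "-1" a A] by simp
    moreover have "a $ i \<le> 0" for i
      using S[of "(- axis i 1, 0)"] by (simp add: S_def inner_axis)
    moreover have "0 \<le> \<alpha>"
      using S[of "(0, 1)"] by (simp add: S_def)
    ultimately have "(- a, \<alpha>) \<in> Pi_cone A c"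
      unfolding Pi_cone_def less_eq_vec_def by auto
    from le[OF this] neg show False
      by simp
  qed
  ultimately show thesis
    using that unfolding T_def by blast
qed

lemma convex_cone_Pi_cone: "convex_cone (Pi_cone A c)"
  unfolding convex_cone_iff Pi_cone_def
  by (auto simp: zero_prod_def vector_matrix_left_distrib scaleR_left_distrib
      scaleR_vector_matrix_assoc intro: add_mono scaleR_nonneg_nonneg)
    (metis scaleR_left_mono scaleR_scaleR)

lemma linear_cut_coeff: "linear (cut_coeff B f)"
  by (rule linearI)
    (auto simp: cut_coeff_def vector_matrix_left_distrib scaleR_vector_matrix_assoc algebra_simps)

lemma sep_objective_eq:
  "sep_objective B b f u p = fst p \<bullet> b - cut_coeff B f p \<bullet> u"
  by (cases u; cases p)
    (simp add: sep_objective_def cut_coeff_def algebra_simps dot_lmul_matrix)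

text \<open>Weak duality for the linear program in \<open>x\<close> at fixed
  \<open>y\<close>.\<close>

lemma sep_objective_le_lp_gap:
  assumes "p \<in> Pi_cone A c" and "x \<in> lp_feasible_set A B b y"
  shows "sep_objective B b f (y, \<eta>) p \<le> snd p * (c \<bullet> x + f \<bullet> y - \<eta>)"
proof -
  obtain \<pi> \<pi>0 where p: "p = (\<pi>, \<pi>0)"
    by (cases p)
  have \<pi>: "\<pi> v* A \<le> \<pi>0 *\<^sub>R c" "0 \<le> \<pi>"
    using assms(1) by (auto simp: p Pi_cone_def)
  have x: "b - B *v y \<le> A *v x" "0 \<le> x"
    using assms(2) by (auto simp: lp_feasible_set_def)
  have "\<pi> \<bullet> (b - B *v y) \<le> \<pi> \<bullet> (A *v x)"
    using inner_nonneg_nonneg[of \<pi> "A *v x - (b - B *v y)"] \<pi> x by (simp add: inner_diff_right)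
  also have "\<dots> = (\<pi> v* A) \<bullet> x"
    by (simp add: dot_lmul_matrix)
  also have "\<dots> \<le> \<pi>0 * (c \<bullet> x)"
    using inner_nonneg_nonneg[of "\<pi>0 *\<^sub>R c - \<pi> v* A" x] \<pi> x by (simp add: inner_diff_left)
  finally show ?thesis
    by (simp add: p sep_objective_def algebra_simps)
qed

text \<open>Weak duality gives the cuts on the epigraph; conversely, \<open>farkas_matrix\<close>
  turns the cuts into a feasible \<open>x\<close> of cost at most
  \<open>\<eta> - f \<bullet> y\<close>.\<close>

lemma mem_epi_Q_iff:
  "u \<in> epi_Q A B b c f \<longleftrightarrow> (\<forall>p \<in> Pi_cone A c. sep_objective B b f u p \<le> 0)"
proof
  obtain y \<eta> where u: "u = (y, \<eta>)"
    by (cases u)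
  let ?L = "lp_feasible_set A B b y"
  {
    assume "u \<in> epi_Q A B b c f"
    then have Q: "Q_value A B b c f y \<le> ereal \<eta>"
      by (simp add: u epi_Q_def)
    show "\<forall>p \<in> Pi_cone A c. sep_objective B b f u p \<le> 0"
    proof
      fix p assume p: "p \<in> Pi_cone A c"
      have nn: "0 \<le> snd p"
        using p by (auto simp: Pi_cone_def)
      \<comment> \<open>\<open>Q_value\<close> is an infimum, so weak duality is applied to a
        \<delta>-approximate minimizer. The 1 in the denominator of \<delta> covers
        \<open>snd p = 0\<close>.\<close>
      have "sep_objective B b f u p \<le> 0 + e" if e: "0 < e" for e
      proof -
        define \<delta> where "\<delta> = e / (snd p + 1)"
        have \<delta>: "0 < \<delta>" and small: "snd p * \<delta> \<le> e"
          using nn e by (simp_all add: \<delta>_def field_simps)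
        have "(INF x \<in> ?L. ereal (c \<bullet> x)) < ereal (\<eta> - f \<bullet> y + \<delta>)"
          using Q \<delta> unfolding Q_value_def
          by (cases "INF x \<in> ?L. ereal (c \<bullet> x)") auto
        then obtain x where x: "x \<in> ?L" "c \<bullet> x < \<eta> - f \<bullet> y + \<delta>"
          by (auto simp: INF_less_iff)
        have "sep_objective B b f u p \<le> snd p * (c \<bullet> x + f \<bullet> y - \<eta>)"
          unfolding u by (rule sep_objective_le_lp_gap[OF p x(1)])
        also have "\<dots> \<le> snd p * \<delta>"
          using nn x(2) by (intro mult_left_mono) auto
        finally show ?thesis
          using small by simp
      qed
      then show "sep_objective B b f u p \<le> 0"
        by (rule field_le_epsilon)
    qed
  }
  {
    assume cuts: "\<forall>p \<in> Pi_cone A c. sep_objective B b f u p \<le> 0"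
    have "\<pi> \<bullet> (b - B *v y) \<le> \<pi>0 * (\<eta> - f \<bullet> y)" if "(\<pi>, \<pi>0) \<in> Pi_cone A c" for \<pi> \<pi>0
      using cuts[rule_format, OF that] by (simp add: u sep_objective_def algebra_simps)
    then obtain x where x: "0 \<le> x" "b - B *v y \<le> A *v x" "c \<bullet> x \<le> \<eta> - f \<bullet> y"
      by (rule farkas_matrix)
    then have L: "x \<in> ?L"
      by (simp add: lp_feasible_set_def)
    then have "(INF x \<in> ?L. ereal (c \<bullet> x)) \<le> ereal (c \<bullet> x)"
      by (rule INF_lower)
    also have "\<dots> \<le> ereal (\<eta> - f \<bullet> y)"
      using x(3) by simp
    finally have "Q_value A B b c f y \<le> ereal \<eta>"
      unfolding Q_value_def by (cases "INF x \<in> ?L. ereal (c \<bullet> x)") auto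
    with L show "u \<in> epi_Q A B b c f"
      by (auto simp: u epi_Q_def dom_Q_def)
  }
qed

text \<open>When \<open>\<tau> = 0\<close> and \<open>\<pi>\<^sub>0 = 0\<close> the violation does not depend on \<open>u\<close>, so a single feasible linear program bounds it.\<close>

lemma sep_objective_nonpos_if_cut_coeff_0:
  assumes "p \<in> Pi_cone A c" and "cut_coeff B f p = 0" and "x \<in> lp_feasible_set A B b y"
  shows "sep_objective B b f u p \<le> 0"
proof -
  have "snd p = 0"
    using assms(2) by (cases p) (simp add: cut_coeff_def zero_prod_def)
  then have "sep_objective B b f (y, 0) p \<le> 0"
    using sep_objective_le_lp_gap[OF assms(1,3), of f 0] by simp
  then show ?thesis
    using assms(2) by (simp add: sep_objective_eq)
qed

lemma gradient_line:
  fixes g :: "'a::euclidean_space \<Rightarrow> real"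
  assumes "g differentiable (at p)"
  shows "((\<lambda>t. g (p + t *\<^sub>R h)) has_real_derivative gradient g p \<bullet> h) (at 0)"
proof -
  have D: "(g has_derivative (\<lambda>h. h \<bullet> gradient g p)) (at (p + 0 *\<^sub>R h))"
    using GDERIV_gradient[OF assms] by (simp add: gderiv_def)
  have "((\<lambda>t. p + t *\<^sub>R h) has_derivative (\<lambda>t. t *\<^sub>R h)) (at 0)"
    by (auto intro!: derivative_eq_intros)
  from has_derivative_compose[OF this D] show ?thesis
    by (simp add: has_field_derivative_def inner_commute mult.commute[of _ "gradient g p \<bullet> h"]
        mult_commute_abs)
qed

text \<open>Otherwise \<phi> - \<psi> would be strictly increasing to the right of its zero
  \<open>x\<close>.\<close>

lemma has_real_derivative_le_at_right:
  fixes \<phi> \<psi> :: "real \<Rightarrow> real"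
  assumes "(\<phi> has_real_derivative a) (at x)" and "(\<psi> has_real_derivative b) (at x)"
    and "\<phi> x = \<psi> x" and "\<And>t. x < t \<Longrightarrow> \<phi> t \<le> \<psi> t"
  shows "a \<le> b"
proof (rule ccontr)
  assume "\<not> a \<le> b"
  then obtain e where "0 < e" and e: "\<forall>h>0. h < e \<longrightarrow> \<phi> x - \<psi> x < \<phi> (x + h) - \<psi> (x + h)"
    using DERIV_pos_inc_right[OF DERIV_diff[OF assms(1,2)]] by auto
  then have "\<phi> x - \<psi> x < \<phi> (x + e / 2) - \<psi> (x + e / 2)"
    by (intro e[rule_format]) auto
  with \<open>0 < e\<close> show False
    using assms(3) assms(4)[of "x + e / 2"] by simp
qed

theorem proposition9:
  fixes A :: "real^'p^'m" and B :: "real^'n^'m" and b :: "real^'m"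
    and c :: "real^'p" and f :: "real^'n" and Y :: "(real^'n) set"
    and g :: "(real^'n) \<times> real \<Rightarrow> real"
    and yhat :: "real^'n" and etahat :: real
    and \<pi>s :: "real^'m" and \<pi>0s :: real and \<tau>s :: "real^'n"
  assumes "Y \<subseteq> {y. \<forall>i. y $ i \<in> \<int>}"
    and "mip_feasible A B b Y"
    and "mip_bounded A B b c f Y"
    and "projective_normalization A B c f g"
    and "(yhat, etahat) \<notin> epi_Q A B b c f"
    and "sep_optimal A B b c f g (yhat, etahat) (\<pi>s, \<pi>0s)"
    and "\<tau>s = \<pi>s v* B - \<pi>0s *\<^sub>R f"
    and "g differentiable (at (\<tau>s, \<pi>0s))"
  shows "let d = sep_value A B b c f g (yhat, etahat);
             S = {z :: real. \<exists>y \<eta>. (y, \<eta>) \<in> epi_Q A B b c f \<and>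
                   (y, \<eta>) = (yhat, etahat) + z *\<^sub>R gradient g (\<tau>s, \<pi>0s)}
         in d \<in> S \<and> (\<forall>z \<in> S. d \<le> z)"
proof -
  define u where "u = (yhat, etahat)"
  define ps where "ps = (\<pi>s, \<pi>0s)"
  let ?P = "Pi_cone A c" and ?q = "cut_coeff B f" and ?obj = "sep_objective B b f"
  define D where "D = gradient g (?q ps)"
  define d where "d = ?obj u ps"
  have qs: "(\<tau>s, \<pi>0s) = ?q ps"
    by (simp add: ps_def cut_coeff_def assms(7))
  have diff: "g differentiable (at (?q ps))"
    using assms(8) qs by simp
  have hom: "g (k *\<^sub>R q) = k * g q" if "0 \<le> k" for k q
    using assms(4) that by (cases q) (simp add: projective_normalization_def)
  have pos: "0 < g (?q p)" if "p \<in> ?P" "?q p \<noteq> 0" for p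
    using assms(4) that unfolding projective_normalization_def cut_coeff_def
    by (cases p) fast
  have P_scale: "k *\<^sub>R p \<in> ?P" if "p \<in> ?P" "0 \<le> k" for k p
    using convex_cone_scaleR[OF convex_cone_Pi_cone] that by blast
  have obj_scale: "?obj u (k *\<^sub>R p) = k * ?obj u p" for k p
    by (simp add: sep_objective_eq linear_cmul[OF linear_cut_coeff] algebra_simps)
  \<comment> \<open>A feasible point of the mixed-integer program provides the feasible linear
    program that \<open>cert\<close> relies on.\<close>
  obtain x0 y0 where "x0 \<in> lp_feasible_set A B b y0"
    using assms(2) by (auto simp: mip_feasible_def mip_feasible_set_def lp_feasible_set_def
        diff_le_eq)
  note cert = sep_objective_nonpos_if_cut_coeff_0[OF _ _ this]
  have ps: "ps \<in> ?P" "g (?q ps) \<le> 1"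
    using assms(6) by (simp_all add: sep_optimal_def is_arg_max_def sep_feasible_set_def ps_def)
  have opt: "?obj u p \<le> d" if "p \<in> ?P" "g (?q p) \<le> 1" for p
    using assms(6) that unfolding u_def ps_def d_def sep_optimal_def is_arg_max_def
      sep_feasible_set_def not_less[symmetric] by blast

  have bound: "?obj u p \<le> d * g (?q p)" if p: "p \<in> ?P" for p
  proof (cases "?q p = 0")
    case True
    then show ?thesis
      using cert[OF p] hom[of 0 0] by simp
  next
    case False
    define k where "k = inverse (g (?q p))"
    have k: "0 < k" "k * g (?q p) = 1"
      using pos[OF p False] by (simp_all add: k_def)
    have "?obj u (k *\<^sub>R p) \<le> d"
      using k by (intro opt P_scale p) (auto simp: linear_cmul[OF linear_cut_coeff] hom)
    then show ?thesis
      using pos[OF p False] by (simp add: obj_scale k_def field_simps)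
  qed
  \<comment> \<open>Some cut is violated at \<open>u\<close>; \<open>cert\<close> makes its
    coefficients nonzero, so \<open>g\<close> is positive there and \<open>bound\<close> forces
    \<open>d\<close> to be positive.\<close>
  have "0 < d"
  proof -
    obtain p where p: "p \<in> ?P" "0 < ?obj u p"
      using assms(5) by (auto simp: mem_epi_Q_iff u_def not_le)
    then have "?q p \<noteq> 0"
      using cert[OF p(1), of f u] by auto
    then have "0 < g (?q p)"
      by (rule pos[OF p(1)])
    moreover have "0 < d * g (?q p)"
      using bound[OF p(1)] p(2) by linarith
    ultimately show ?thesis
      by (simp add: zero_less_mult_iff)
  qed
  \<comment> \<open>At \<open>ps\<close> the inequality \<open>bound\<close> reads
    \<open>d \<le> d * g (?q ps)\<close>, so the normalization is tight.\<close>
  have g1: "g (?q ps) = 1"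
    using bound[OF ps(1)] ps(2) \<open>0 < d\<close> by (simp add: d_def)

  have euler: "D \<bullet> ?q ps = 1"
  proof -
    have "((\<lambda>t. g (?q ps + t *\<^sub>R ?q ps)) has_real_derivative D \<bullet> ?q ps) (at 0)"
      unfolding D_def by (rule gradient_line[OF diff])
    moreover have "((\<lambda>t. g (?q ps + t *\<^sub>R ?q ps)) has_real_derivative 1) (at 0)"
    proof (rule has_field_derivative_transform_within)
      show "((\<lambda>t. 1 + t) has_real_derivative 1) (at 0)"
        by (auto intro!: derivative_eq_intros)
      \<comment> \<open>The radius 1 keeps the factor \<open>1 + t\<close> nonnegative, as
        homogeneity requires.\<close>
      show "1 + t = g (?q ps + t *\<^sub>R ?q ps)" if "dist t 0 < 1" for t
        using hom[of "1 + t" "?q ps"] that g1 by (simp add: scaleR_left_distrib)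
    qed auto
    ultimately show ?thesis
      by (rule DERIV_unique)
  qed
  \<comment> \<open>Along \<open>ps + t *\<^sub>R p\<close> the two sides of \<open>bound\<close>
    agree at \<open>t = 0\<close> and are ordered for \<open>t > 0\<close>, so their derivatives at
    0 are ordered too.\<close>
  have directional: "?obj u p \<le> d * (D \<bullet> ?q p)" if p: "p \<in> ?P" for p
  proof (rule has_real_derivative_le_at_right)
    show "((\<lambda>t. d + t * ?obj u p) has_real_derivative ?obj u p) (at 0)"
      by (auto intro!: derivative_eq_intros)
    show "((\<lambda>t. d * g (?q ps + t *\<^sub>R ?q p)) has_real_derivative d * (D \<bullet> ?q p)) (at 0)"
      unfolding D_def by (intro DERIV_cmult gradient_line diff)
    show "d + 0 * ?obj u p = d * g (?q ps + 0 *\<^sub>R ?q p)"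
      by (simp add: g1)
    fix t :: real assume "0 < t"
    then have "ps + t *\<^sub>R p \<in> ?P"
      using convex_cone_add[OF convex_cone_Pi_cone ps(1) P_scale[OF p]] by simp
    from bound[OF this] show "d + t * ?obj u p \<le> d * g (?q ps + t *\<^sub>R ?q p)"
      by (simp add: d_def sep_objective_eq linear_add[OF linear_cut_coeff]
          linear_cmul[OF linear_cut_coeff] algebra_simps)
  qed
  have ray: "?obj (u + z *\<^sub>R D) p = ?obj u p - z * (D \<bullet> ?q p)" for z p
    by (simp add: sep_objective_eq inner_add_right inner_commute)

  have "sep_value A B b c f g u = d"
    unfolding sep_value_def
  proof (rule cSup_eq_maximum)
    show "d \<in> ?obj u ` sep_feasible_set A B c f g"
      using ps by (auto simp: d_def sep_feasible_set_def)
    show "x \<le> d" if "x \<in> ?obj u ` sep_feasible_set A B c f g" for x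
      using that opt by (auto simp: sep_feasible_set_def)
  qed
  moreover have "u + d *\<^sub>R D \<in> epi_Q A B b c f"
    using directional by (simp add: mem_epi_Q_iff ray)
  \<comment> \<open>By \<open>euler\<close>, the violation of the optimal cut at
    \<open>u + z *\<^sub>R D\<close> is \<open>d - z\<close>.\<close>
  moreover have "d \<le> z" if "u + z *\<^sub>R D \<in> epi_Q A B b c f" for z
    using that ps(1) by (auto simp: mem_epi_Q_iff ray d_def euler dest: bspec[where x = ps])
  ultimately show ?thesis
    unfolding Let_def qs u_def[symmetric] D_def[symmetric]
    by auto (metis surj_pair)
qed

end
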